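(* Let $1\le p<\infty$ and let $p^*$ be given by $1=\frac1p+\frac1{p^*}$. Then $\mathcal D_{p^*}\subseteq W_p^{\mathrm{mid}}$; that is, for all Banach spaces $E,F$, every Cohen strongly $p^*$-summing operator $T\in\mathcal L(E;F)$ belongs to $W_p^{\mathrm{mid}}(E;F)$.
   Context: Banach spaces are over $\mathbb K=\mathbb R$ or $\mathbb C$; $\mathcal L(E;F)$ is the space of continuous linear operators. For $1\le p<\infty$, $\ell_p^w(E)$ is the space of sequences $(x_j)_{j=1}^\infty$ in $E$ with $\|(x_j)_j\|_{w,p}:=\sup_{\varphi\in B_{E^*}}(\sum_{j}|\varphi(x_j)|^p)^{1/p}<\infty$. For $1<p^*\le\infty$ with conjugate exponent $p$, $\mathcal D_{p^*}(E;F)$ denotes the class of Cohen strongly $p^*$-summing operators: $T\in\mathcal L(E;F)$ for which there is $C>0$ with $\sum_{j=1}^k|y_j^*(T(x_j))|\le C\,\|(x_j)_{j=1}^k\|_{p^*}\,\|(y_j^* )_{j=1}^k\|_{w,p}$ for all $k\in\mathbb N$, $x_1,\dots,x_k\in E$, $y_1^*,\dots,y_k^*\in F^*$, where $\|(x_j)_{j=1}^k\|_{p^*}$ is the $\ell_{p^*}$-norm of $(\|x_j\|)_{j=1}^k$. The space $\ell_p^{\mathrm{mid}}(F)$ consists of the sequences $(y_j)_{j=1}^\infty$ in $F$ with $\sum_{j=1}^\infty\sum_{n=1}^\infty|y_n^*(y_j)|^p<\infty$ for every $(y_n^* )_n\in\ell_p^w(F^* )$. $W_p^{\mathrm{mid}}(E;F)$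 is the set of $T\in\mathcal L(E;F)$ such that $(T(x_j))_j\in\ell_p^{\mathrm{mid}}(F)$ whenever $(x_j)_j\in\ell_p^w(E)$. *)

theory Defs
  imports "HOL-Analysis.Analysis"
begin

(* The scalar field K: the two disjuncts say that K is isometrically isomorphic,
   as a normed field, to the reals or to the complex numbers. *)
class rc_field = real_normed_field +
  assumes real_or_complex:
    "(\<forall>z. \<exists>a. z = a *\<^sub>R 1) \<or>
     (\<exists>i. i * i = - 1 \<and> (\<forall>z. \<exists>a b. z = a *\<^sub>R 1 + b *\<^sub>R i)
        \<and> (\<forall>a b. norm (a *\<^sub>R 1 + b *\<^sub>R i) = sqrt (a\<^sup>2 + b\<^sup>2)))"

instance real :: rc_field
  by standard simp

instance complex :: rc_field
proof
  have "\<i> * \<i> = - 1 \<and> (\<forall>z. \<exists>a b. z = a *\<^sub>R 1 + b *\<^sub>R \<i>)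
      \<and> (\<forall>a b. norm (a *\<^sub>R 1 + b *\<^sub>R \<i>) = sqrt (a\<^sup>2 + b\<^sup>2))"
  proof (intro conjI allI)
    fix z :: complex
    have "z = Re z *\<^sub>R 1 + Im z *\<^sub>R \<i>"
      by (simp add: complex_eq_iff)
    then show "\<exists>a b. z = a *\<^sub>R 1 + b *\<^sub>R \<i>" by blast
  qed (simp_all add: cmod_def)
  then show "(\<forall>z :: complex. \<exists>a. z = a *\<^sub>R 1) \<or>
     (\<exists>i :: complex. i * i = - 1 \<and> (\<forall>z. \<exists>a b. z = a *\<^sub>R 1 + b *\<^sub>R i)
        \<and> (\<forall>a b. norm (a *\<^sub>R 1 + b *\<^sub>R i) = sqrt (a\<^sup>2 + b\<^sup>2)))"
    by blast
qed

(* A Banach space over K: the sort banach supplies addition, the complete norm and the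
   underlying real structure; the locale adds a compatible scalar multiplication by K. *)
locale banach_over = vector_space scale
  for scale :: "'k::rc_field \<Rightarrow> 'a::banach \<Rightarrow> 'a" +
  assumes scale_of_real: "scale (of_real r) x = r *\<^sub>R x"
    and norm_scale: "norm (scale c x) = norm c * norm x"

lemma banach_over_real: "banach_over (scaleR :: real \<Rightarrow> 'a::banach \<Rightarrow> 'a)"
  by unfold_locales (simp_all add: algebra_simps)

lemma banach_over_complex: "banach_over ((*) :: complex \<Rightarrow> complex \<Rightarrow> complex)"
  by unfold_locales (simp_all add: algebra_simps norm_mult scaleR_conv_of_real)

(* L(E;F): among the bounded real-linear maps, those that are linear over K. *)
definition operators ::
  "('k::rc_field \<Rightarrow> 'e::real_normed_vector \<Rightarrow> 'e) \<Rightarrow> ('k \<Rightarrow> 'f::real_normed_vector \<Rightarrow> 'f)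
    \<Rightarrow> ('e \<Rightarrow>\<^sub>L 'f) set" where
  "operators sE sF = {T. Vector_Spaces.linear sE sF (blinfun_apply T)}"

(* The topological dual, normed by the operator norm of the type of bounded linear maps,
   and its scalar multiplication (c f)(x) = c * f x. *)
definition dual_space ::
  "('k::rc_field \<Rightarrow> 'a::real_normed_vector \<Rightarrow> 'a) \<Rightarrow> ('a \<Rightarrow>\<^sub>L 'k) set" where
  "dual_space s = operators s (*)"

definition dual_scale ::
  "'k::rc_field \<Rightarrow> ('a::real_normed_vector \<Rightarrow>\<^sub>L 'k) \<Rightarrow> ('a \<Rightarrow>\<^sub>L 'k)" where
  "dual_scale c f = blinfun_mult_right c o\<^sub>L f"

(* Closed unit ball of the dual of a K-subspace V (with the norm of the ambient type).
   A carrier V is needed because F^* is a proper subset of its type when K is complex;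
   weak norms in F^* use the functionals on V = dual_space sF, i.e. the ball of F^**.
   Values outside V are irrelevant. *)
definition dual_ball ::
  "('k::rc_field \<Rightarrow> 'a::real_normed_vector \<Rightarrow> 'a) \<Rightarrow> 'a set \<Rightarrow> ('a \<Rightarrow> 'k) set" where
  "dual_ball s V = {f. (\<forall>x\<in>V. \<forall>y\<in>V. f (x + y) = f x + f y)
     \<and> (\<forall>c. \<forall>x\<in>V. f (s c x) = c * f x)
     \<and> (\<forall>x\<in>V. norm (f x) \<le> norm x)}"

definition weak_norm ::
  "real \<Rightarrow> ('k::rc_field \<Rightarrow> 'a::real_normed_vector \<Rightarrow> 'a) \<Rightarrow> 'a set \<Rightarrow> (nat \<Rightarrow> 'a) \<Rightarrow> real" where
  "weak_norm p s V x =
     (SUP f\<in>dual_ball s V. (\<Sum>j. norm (f (x j)) powr p) powr (1 / p))"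

(* The weakly p-summable sequences in V; the summability and boundedness conditions
   say that the supremum defining weak_norm is finite. *)
definition weak_lp ::
  "real \<Rightarrow> ('k::rc_field \<Rightarrow> 'a::real_normed_vector \<Rightarrow> 'a) \<Rightarrow> 'a set \<Rightarrow> (nat \<Rightarrow> 'a) set" where
  "weak_lp p s V = {x. range x \<subseteq> V
     \<and> (\<forall>f\<in>dual_ball s V. summable (\<lambda>j. norm (f (x j)) powr p))
     \<and> bdd_above ((\<lambda>f. (\<Sum>j. norm (f (x j)) powr p) powr (1 / p)) ` dual_ball s V)}"

(* The l_q norm of the finite family (x_j), j < k, with 1 <= q <= infinity. *)
definition lq_norm_fin :: "ennreal \<Rightarrow> nat \<Rightarrow> (nat \<Rightarrow> 'a::real_normed_vector) \<Rightarrow> real" where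
  "lq_norm_fin q k x =
     (if q = \<infinity> then Max (insert 0 ((\<lambda>j. norm (x j)) ` {..<k}))
      else (\<Sum>j<k. norm (x j) powr enn2real q) powr (1 / enn2real q))"

definition conjugate_exponents :: "real \<Rightarrow> ennreal \<Rightarrow> bool" where
  "conjugate_exponents p q \<longleftrightarrow> 1 \<le> p \<and> 1 = 1 / ennreal p + 1 / q"

(* D_q(E;F), with q in (1, infinity] in the role of p^*; it determines its conjugate p.
   A finite family in F^* is a sequence extended by zero. *)
definition cohen_strongly_summing ::
  "ennreal \<Rightarrow> ('k::rc_field \<Rightarrow> 'e::banach \<Rightarrow> 'e) \<Rightarrow> ('k \<Rightarrow> 'f::banach \<Rightarrow> 'f) \<Rightarrow> ('e \<Rightarrow>\<^sub>L 'f) set" where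
  "cohen_strongly_summing q sE sF = {T \<in> operators sE sF.
     \<exists>p. conjugate_exponents p q \<and>
       (\<exists>C>0. \<forall>k x y. (\<forall>j<k. y j \<in> dual_space sF) \<longrightarrow>
          (\<Sum>j<k. norm (blinfun_apply (y j) (blinfun_apply T (x j))))
            \<le> C * lq_norm_fin q k x
                * weak_norm p dual_scale (dual_space sF) (\<lambda>j. if j < k then y j else 0))}"

(* Convergence of the iterated series of nonnegative terms, sum over j of sum over n. *)
definition mid_lp ::
  "real \<Rightarrow> ('k::rc_field \<Rightarrow> 'f::banach \<Rightarrow> 'f) \<Rightarrow> (nat \<Rightarrow> 'f) set" where
  "mid_lp p sF = {y. \<forall>ys \<in> weak_lp p dual_scale (dual_space sF).
     (\<forall>j. summable (\<lambda>n. norm (blinfun_apply (ys n) (y j)) powr p))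
     \<and> summable (\<lambda>j. \<Sum>n. norm (blinfun_apply (ys n) (y j)) powr p)}"

definition W_mid ::
  "real \<Rightarrow> ('k::rc_field \<Rightarrow> 'e::banach \<Rightarrow> 'e) \<Rightarrow> ('k \<Rightarrow> 'f::banach \<Rightarrow> 'f) \<Rightarrow> ('e \<Rightarrow>\<^sub>L 'f) set" where
  "W_mid p sE sF = {T \<in> operators sE sF.
     \<forall>x \<in> weak_lp p sE UNIV. (\<lambda>j. blinfun_apply T (x j)) \<in> mid_lp p sF}"

lemma dual_ball_UNIV:
  assumes "banach_over s"
  shows "dual_ball s UNIV = blinfun_apply ` {f \<in> dual_space s. norm f \<le> 1}"
proof -
  interpret banach_over s by fact
  have vs: "vector_space ((*) :: 'a \<Rightarrow> 'a \<Rightarrow> 'a)"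
    by unfold_locales (simp_all add: algebra_simps)
  show ?thesis
  proof (intro equalityI subsetI)
    fix f assume f: "f \<in> dual_ball s UNIV"
    then have lin: "f (x + y) = f x + f y" "f (s c x) = c * f x" "norm (f x) \<le> norm x"
      for x y c by (auto simp: dual_ball_def)
    have bl: "bounded_linear f"
    proof (rule bounded_linear_intro[where K = 1])
      fix r x show "f (r *\<^sub>R x) = r *\<^sub>R f x"
        using lin(2)[of "of_real r" x] by (simp add: scale_of_real scaleR_conv_of_real)
    qed (use lin in auto)
    then have app: "blinfun_apply (Blinfun f) = f" by (rule bounded_linear_Blinfun_apply)
    have "Vector_Spaces.linear s (*) f"
      using vector_space_axioms vs lin
      by (simp add: Vector_Spaces.linear_def module_hom_def module_hom_axioms_def module_iff_vector_space)
    moreover have "norm (Blinfun f) \<le> 1"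
      by (rule norm_blinfun_bound) (use lin app in auto)
    ultimately show "f \<in> blinfun_apply ` {f \<in> dual_space s. norm f \<le> 1}"
      using app by (intro image_eqI[of _ _ "Blinfun f"]) (auto simp: dual_space_def operators_def)
  next
    fix f assume "f \<in> blinfun_apply ` {f \<in> dual_space s. norm f \<le> 1}"
    then obtain g where g: "f = blinfun_apply g" "Vector_Spaces.linear s (*) (blinfun_apply g)"
      "norm g \<le> 1" by (auto simp: dual_space_def operators_def)
    then have "module_hom s (*) f" by (simp add: module_hom_iff_linear)
    moreover have "norm (f x) \<le> norm x" for x
      using norm_blinfun[of g x] mult_right_mono[OF g(3), of "norm x"] g(1) by simp
    ultimately show "f \<in> dual_ball s UNIV"
      by (auto simp: dual_ball_def module_hom.add module_hom.scale)
  qed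
qed

end

theory Submission
  imports Defs
begin

text \<open>
  The idea is duality. If \<open>T\<close> is Cohen strongly \<open>p\<^sup>*\<close>-summing, then its adjoint
  \<open>y\<^sup>* \<mapsto> y\<^sup>* \<circ> T\<close> is absolutely \<open>p\<close>-summing: it sends a weakly \<open>p\<close>-summable sequence
  \<open>(y\<^sub>n\<^sup>*)\<close> to a sequence with \<open>\<Sum>\<^sub>n \<parallel>y\<^sub>n\<^sup>* \<circ> T\<parallel>\<^sup>p < \<infinity>\<close>
  (\<open>cohen_adjoint_summing\<close>). Testing the defining inequality on \<open>\<lambda>\<^sub>n u\<^sub>n\<close>, where the unit
  vectors \<open>u\<^sub>n\<close> nearly attain \<open>\<parallel>y\<^sub>n\<^sup>* \<circ> T\<parallel>\<close> and \<open>\<lambda>\<close> is arbitrary, bounds the pairing of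
  \<open>(\<parallel>y\<^sub>n\<^sup>* \<circ> T\<parallel>)\<close> with \<open>\<lambda>\<close> by a multiple of the \<open>\<ell>\<^bsub>p*\<^esub>\<close> norm of \<open>\<lambda>\<close>; the converse
  of Hoelder's inequality (\<open>converse_Hoelder_fin\<close>) turns this into a bound on the \<open>\<ell>\<^sub>p\<close> norm.

  On the other side, a weakly \<open>p\<close>-summable sequence \<open>(x\<^sub>j)\<close> satisfies
  \<open>\<Sum>\<^sub>j |g(x\<^sub>j)|\<^sup>p \<le> \<parallel>g\<parallel>\<^sup>p \<parallel>(x\<^sub>j)\<parallel>\<^sup>p\<close> (weak norm on the right) for every continuous
  functional \<open>g\<close> (\<open>weak_lp_functional\<close>). Taking \<open>g = y\<^sub>n\<^sup>* \<circ> T\<close>, summing over \<open>n\<close> and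
  exchanging the two sums of nonnegative terms gives the convergence of
  \<open>\<Sum>\<^sub>j \<Sum>\<^sub>n |y\<^sub>n\<^sup>*(T x\<^sub>j)|\<^sup>p\<close>.
\<close>

section \<open>Conjugate exponents and finite Hoelder duality\<close>

text \<open>
  Being Cohen strongly \<open>q\<close>-summing refers to an unnamed exponent conjugate to \<open>q\<close>;
  uniqueness identifies it with the given \<open>p\<close>.
\<close>

lemma conjugate_exponents_unique:
  assumes "conjugate_exponents p q" "conjugate_exponents p' q"
  shows "p = p'"
proof -
  have p: "p \<ge> 1" "p' \<ge> 1" using assms by (auto simp: conjugate_exponents_def)
  have e: "1 / ennreal p + 1 / q = 1" "1 / ennreal p' + 1 / q = 1"
    using assms by (auto simp: conjugate_exponents_def)
  have "1 / q \<noteq> \<infinity>"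
  proof
    assume "1 / q = \<infinity>"
    with e(1) show False by simp
  qed
  then have "1 / ennreal p = 1 / ennreal p'"
    using e by (metis ennreal_add_diff_cancel_right infinity_ennreal_def)
  moreover have "1 / ennreal p = ennreal (1 / p)" "1 / ennreal p' = ennreal (1 / p')"
    using p by (simp_all add: divide_ennreal flip: ennreal_1)
  ultimately have "1 / p = 1 / p'" using p by simp
  then show ?thesis using p by simp
qed

text \<open>Splitting off \<open>q = \<infinity>\<close> replaces extended arithmetic by an identity between reals.\<close>

lemma conjugate_exponents_cases:
  assumes "conjugate_exponents p q"
  obtains (infinite) "p = 1" "q = \<infinity>"
  | (finite) r where "1 < p" "0 < r" "q = ennreal r" "1 / p + 1 / r = 1"
proof -
  have p: "p \<ge> 1" and e: "1 / ennreal p + 1 / q = 1"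
    using assms by (auto simp: conjugate_exponents_def)
  have ep: "1 / ennreal p = ennreal (1 / p)"
    using p by (simp add: divide_ennreal flip: ennreal_1)
  show thesis
  proof (cases q)
    case top
    with e ep have "ennreal (1 / p) = ennreal 1" by simp
    then have "1 / p = 1" using p by (simp del: ennreal_1)
    with p top show ?thesis by (intro infinite) auto
  next
    case (real r)
    have "r \<noteq> 0"
    proof
      assume "r = 0"
      with e real show False by (simp add: ennreal_divide_zero)
    qed
    with real have r: "r > 0" by simp
    then have "1 / q = ennreal (1 / r)"
      using real by (simp add: divide_ennreal flip: ennreal_1)
    with e ep have "ennreal (1 / p + 1 / r) = ennreal 1"
      using p r by simp
    moreover have "0 \<le> 1 / p + 1 / r" using p r by simp
    ultimately have pr: "1 / p + 1 / r = 1" by (simp del: ennreal_1)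
    have "p \<noteq> 1" using pr r by auto
    with p r pr real show ?thesis by (intro finite) auto
  qed
qed

lemma lq_norm_fin_mono:
  fixes x :: "nat \<Rightarrow> 'a::real_normed_vector" and y :: "nat \<Rightarrow> 'b::real_normed_vector"
  assumes "\<And>j. j < k \<Longrightarrow> norm (x j) \<le> norm (y j)"
  shows "lq_norm_fin q k x \<le> lq_norm_fin q k y"
proof (cases "q = \<infinity>")
  case True
  have "Max (insert 0 ((\<lambda>j. norm (x j)) ` {..<k})) \<le> Max (insert 0 ((\<lambda>j. norm (y j)) ` {..<k}))"
  proof (rule Max.boundedI)
    fix a assume "a \<in> insert 0 ((\<lambda>j. norm (x j)) ` {..<k})"
    then consider "a = 0" | j where "j < k" "a = norm (x j)" by auto
    then show "a \<le> Max (insert 0 ((\<lambda>j. norm (y j)) ` {..<k}))"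
    proof cases
      case 1
      then show ?thesis by simp
    next
      case 2
      then have "norm (y j) \<le> Max (insert 0 ((\<lambda>j. norm (y j)) ` {..<k}))"
        by (intro Max_ge) auto
      with 2 assms[of j] show ?thesis by linarith
    qed
  qed simp_all
  then show ?thesis using True by (simp add: lq_norm_fin_def)
next
  case False
  have "(\<Sum>j<k. norm (x j) powr enn2real q) \<le> (\<Sum>j<k. norm (y j) powr enn2real q)"
    by (intro sum_mono powr_mono2) (auto intro: assms)
  then show ?thesis using False
    by (auto simp: lq_norm_fin_def intro!: powr_mono2 sum_nonneg)
qed

lemma lq_norm_fin_nonneg: "0 \<le> lq_norm_fin q k x"
  by (simp add: lq_norm_fin_def)

text \<open>
  The extremal weights are \<open>\<lambda>\<^sub>j = a\<^sub>j\<^bsup>p-1\<^esup>\<close>: since \<open>(p - 1) r = p\<close> for the finite conjugate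
  exponent \<open>r\<close>, both the pairing and the \<open>r\<close>-th powers of the weights sum to \<open>S = \<Sum>\<^sub>j a\<^sub>j\<^sup>p\<close>,
  so the hypothesis reads \<open>S \<le> K S\<^bsup>1/r\<^esup>\<close>. For \<open>p = 1\<close> the weights are constantly 1.
\<close>

lemma converse_Hoelder_fin:
  fixes a :: "nat \<Rightarrow> real"
  assumes pq: "conjugate_exponents p q" and "0 \<le> K" and a: "\<And>j. 0 \<le> a j"
    and le: "\<And>l :: nat \<Rightarrow> real. (\<And>j. 0 \<le> l j) \<Longrightarrow> (\<Sum>j<k. l j * a j) \<le> K * lq_norm_fin q k l"
  shows "(\<Sum>j<k. a j powr p) \<le> K powr p"
  using pq
proof (cases rule: conjugate_exponents_cases)
  case infinite
  have "lq_norm_fin q k (\<lambda>j. 1 :: real) \<le> 1"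
    using infinite by (auto simp: lq_norm_fin_def)
  then have "K * lq_norm_fin q k (\<lambda>j. 1 :: real) \<le> K"
    using \<open>0 \<le> K\<close> by (simp add: mult_left_le)
  with le[of "\<lambda>j. 1"] infinite a \<open>0 \<le> K\<close> show ?thesis by simp
next
  case (finite r)
  define S where "S = (\<Sum>j<k. a j powr p)"
  have S0: "S \<ge> 0" unfolding S_def by (intro sum_nonneg) simp
  have pr: "(p - 1) * r = p" using finite by (simp add: field_simps)
  have "a j powr (p - 1) * a j = a j powr p" for j
    using a[of j] powr_add[of "a j" "p - 1" 1] by (cases "a j = 0") auto
  moreover have "lq_norm_fin q k (\<lambda>j. a j powr (p - 1)) = S powr (1 / r)"
    using finite by (simp add: lq_norm_fin_def S_def powr_powr pr)
  ultimately have S: "S \<le> K * S powr (1 / r)"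
    using le[of "\<lambda>j. a j powr (p - 1)"] by (simp add: S_def)
  show ?thesis
  proof (cases "S = 0")
    case False
    with S0 have "S > 0" by simp
    have "S powr (1 / p) * S powr (1 / r) = S"
      using finite \<open>S > 0\<close> by (simp flip: powr_add)
    with S have "S powr (1 / p) * S powr (1 / r) \<le> K * S powr (1 / r)" by simp
    then have "S powr (1 / p) \<le> K"
      using \<open>S > 0\<close> by simp
    then have "(S powr (1 / p)) powr p \<le> K powr p"
      using finite by (intro powr_mono2) auto
    then show ?thesis using finite \<open>S > 0\<close> by (simp add: powr_powr S_def)
  qed (simp add: S_def)
qed

section \<open>Weakly summable sequences\<close>

lemma zero_in_dual_ball: "(\<lambda>_. 0) \<in> dual_ball s V"
  by (simp add: dual_ball_def)

lemma dual_ball_zero: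
  assumes "f \<in> dual_ball s V" "0 \<in> V"
  shows "f 0 = 0"
proof -
  have "\<forall>x\<in>V. norm (f x) \<le> norm x" using assms(1) by (simp add: dual_ball_def)
  with assms(2) show ?thesis by force
qed

lemma zero_in_dual_space:
  assumes "banach_over s"
  shows "0 \<in> dual_space s"
proof -
  interpret banach_over s by fact
  have "vector_space ((*) :: 'a \<Rightarrow> 'a \<Rightarrow> 'a)"
    by unfold_locales (simp_all add: algebra_simps)
  then show ?thesis
    using vector_space_axioms
    by (simp add: dual_space_def operators_def Vector_Spaces.linear_def module_hom_def
        module_hom_axioms_def module_iff_vector_space)
qed

lemma weak_norm_upper:
  assumes "x \<in> weak_lp p s V" "f \<in> dual_ball s V"
  shows "(\<Sum>j. norm (f (x j)) powr p) powr (1 / p) \<le> weak_norm p s V x"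
  using assms unfolding weak_lp_def weak_norm_def by (intro cSUP_upper) auto

lemma weak_norm_nonneg:
  assumes "x \<in> weak_lp p s V"
  shows "0 \<le> weak_norm p s V x"
  using weak_norm_upper[OF assms zero_in_dual_ball] by simp

text \<open>
  The inequality for Cohen strongly summing operators concerns finite families; this makes its
  right-hand side uniform over the initial segments of a weakly summable sequence.
\<close>

lemma weak_norm_truncate_le:
  assumes x: "x \<in> weak_lp p s V" and "0 \<in> V" "1 \<le> p"
  shows "weak_norm p s V (\<lambda>j. if j < k then x j else 0) \<le> weak_norm p s V x"
  unfolding weak_norm_def[of _ _ _ "\<lambda>j. if j < k then x j else 0"]
proof (rule cSUP_least)
  show "dual_ball s V \<noteq> {}" using zero_in_dual_ball by blast
next
  fix f assume f: "f \<in> dual_ball s V"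
  have sm: "summable (\<lambda>j. norm (f (x j)) powr p)"
    using x f by (auto simp: weak_lp_def)
  have "(\<Sum>j. norm (f (if j < k then x j else 0)) powr p) = (\<Sum>j<k. norm (f (x j)) powr p)"
    using dual_ball_zero[OF f \<open>0 \<in> V\<close>] \<open>1 \<le> p\<close>
    by (subst suminf_finite[of "{..<k}"]) auto
  also have "\<dots> \<le> (\<Sum>j. norm (f (x j)) powr p)"
    by (intro sum_le_suminf sm) auto
  finally have "(\<Sum>j. norm (f (if j < k then x j else 0)) powr p) powr (1 / p)
      \<le> (\<Sum>j. norm (f (x j)) powr p) powr (1 / p)"
    using \<open>1 \<le> p\<close> \<open>_ = (\<Sum>j<k. norm (f (x j)) powr p)\<close>
    by (intro powr_mono2) (auto intro: sum_nonneg)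
  also have "\<dots> \<le> weak_norm p s V x" by (rule weak_norm_upper[OF x f])
  finally show "(\<Sum>j. norm (f (if j < k then x j else 0)) powr p) powr (1 / p) \<le> weak_norm p s V x" .
qed

text \<open>
  Normalising \<open>g\<close> to a functional in the unit ball reduces the bound to the supremum that
  defines the weak norm.
\<close>

lemma weak_lp_functional:
  assumes s: "banach_over s" and x: "x \<in> weak_lp p s UNIV" and g: "g \<in> dual_space s" and "1 \<le> p"
  shows "(\<Sum>j<m. norm (blinfun_apply g (x j)) powr p)
     \<le> norm g powr p * weak_norm p s UNIV x powr p"
proof (cases "g = 0")
  case True
  then show ?thesis by simp
next
  case False
  define c where "c = norm g"
  have c: "c > 0" using False by (simp add: c_def)
  define f where "f y = blinfun_apply g y /\<^sub>R c" for y
  have hom: "module_hom s (*) (blinfun_apply g)"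
    using g by (simp add: dual_space_def operators_def module_hom_iff_linear)
  have f: "f \<in> dual_ball s UNIV"
    unfolding dual_ball_def
  proof (intro CollectI conjI allI ballI)
    fix y z a
    show "f (y + z) = f y + f z" "f (s a y) = a * f y"
      by (simp_all add: f_def module_hom.add[OF hom] module_hom.scale[OF hom] scaleR_right_distrib)
    show "norm (f y) \<le> norm y"
      using c norm_blinfun[of g y] by (simp add: f_def c_def field_simps)
  qed
  have sm: "summable (\<lambda>j. norm (f (x j)) powr p)"
    using x f by (auto simp: weak_lp_def)
  define S where "S = (\<Sum>j. norm (f (x j)) powr p)"
  have S0: "S \<ge> 0" unfolding S_def by (intro suminf_nonneg sm) simp
  have "S = (S powr (1 / p)) powr p" using S0 \<open>1 \<le> p\<close> by (simp add: powr_powr)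
  also have "\<dots> \<le> weak_norm p s UNIV x powr p"
    using weak_norm_upper[OF x f] \<open>1 \<le> p\<close> by (intro powr_mono2) (auto simp: S_def)
  finally have S: "S \<le> weak_norm p s UNIV x powr p" .
  have "norm (blinfun_apply g (x j)) = c * norm (f (x j))" for j
    using c by (simp add: f_def)
  then have "(\<Sum>j<m. norm (blinfun_apply g (x j)) powr p) = c powr p * (\<Sum>j<m. norm (f (x j)) powr p)"
    using c by (simp add: powr_mult sum_distrib_left)
  also have "(\<Sum>j<m. norm (f (x j)) powr p) \<le> S"
    unfolding S_def by (intro sum_le_suminf sm) auto
  also note S
  finally show ?thesis by (simp add: c_def mult_left_mono)
qed

section \<open>The adjoint of a Cohen strongly summing operator\<close>

text \<open>
  The norm of a functional need not be attained on the unit ball. Summability is insensitive to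
  constant factors, so attaining half of it is enough.
\<close>

lemma blinfun_nearly_attains_norm:
  fixes g :: "'a::real_normed_vector \<Rightarrow>\<^sub>L 'b::real_normed_vector"
  shows "\<exists>u. norm u \<le> 1 \<and> norm g \<le> 2 * norm (blinfun_apply g u)"
proof (rule ccontr)
  assume "\<not> ?thesis"
  then have less: "norm (blinfun_apply g u) < norm g / 2" if "norm u \<le> 1" for u
    using that by force
  have "norm (blinfun_apply g x) \<le> norm g / 2 * norm x" for x
  proof (cases "x = 0")
    case False
    have "norm (blinfun_apply g (x /\<^sub>R norm x)) < norm g / 2"
      using False by (intro less) simp
    then show ?thesis using False by (simp add: blinfun.scaleR_right field_simps)
  qed simp
  then have "norm g \<le> norm g / 2" by (intro norm_blinfun_bound) auto
  moreover have "norm g > 0" using less[of 0] by simp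
  ultimately show False by simp
qed

lemma operators_compose:
  assumes "T \<in> operators sE sF" "y \<in> dual_space sF"
  shows "y o\<^sub>L T \<in> dual_space sE"
proof -
  have "Vector_Spaces.linear sE (*) (blinfun_apply y \<circ> blinfun_apply T)"
    using assms by (auto simp: dual_space_def operators_def intro: Vector_Spaces.linear_compose)
  then show ?thesis
    by (simp add: dual_space_def operators_def blinfun_compose.rep_eq o_def)
qed

text \<open>
  The weights are put on the vectors, as \<open>l j *\<^sub>R u j\<close>, and not on the functionals: then the weak
  norm of the functionals stays bounded independently of \<open>l\<close>, and the strong norm of the
  vectors is at most that of \<open>l\<close>, which is what Hoelder duality needs.
\<close>

lemma cohen_adjoint_summing:
  assumes T: "T \<in> cohen_strongly_summing q sE sF" and pq: "conjugate_exponents p q"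
    and sF: "banach_over sF" and y: "y \<in> weak_lp p dual_scale (dual_space sF)"
  shows "summable (\<lambda>n. norm (y n o\<^sub>L T) powr p)"
proof -
  obtain C where C: "C > 0" and le: "\<And>k x y. (\<And>j. j < k \<Longrightarrow> y j \<in> dual_space sF) \<Longrightarrow>
      (\<Sum>j<k. norm (blinfun_apply (y j) (blinfun_apply T (x j)))) \<le> C * lq_norm_fin q k x
         * weak_norm p dual_scale (dual_space sF) (\<lambda>j. if j < k then y j else 0)"
    using T conjugate_exponents_unique[OF pq] unfolding cohen_strongly_summing_def by blast
  have p: "1 \<le> p" using pq by (simp add: conjugate_exponents_def)
  have yV: "y n \<in> dual_space sF" for n using y by (auto simp: weak_lp_def)
  define W where "W = weak_norm p dual_scale (dual_space sF) y"
  have W0: "W \<ge> 0" unfolding W_def by (rule weak_norm_nonneg[OF y])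
  have "\<forall>n. \<exists>u. norm u \<le> 1 \<and> norm (y n o\<^sub>L T) \<le> 2 * norm (blinfun_apply (y n o\<^sub>L T) u)"
    using blinfun_nearly_attains_norm by blast
  then obtain u where u: "norm (u n) \<le> 1"
    "norm (y n o\<^sub>L T) \<le> 2 * norm (blinfun_apply (y n o\<^sub>L T) (u n))" for n
    unfolding choice_iff by blast
  define a where "a n = norm (blinfun_apply (y n o\<^sub>L T) (u n))" for n
  have bound: "(\<Sum>n<k. a n powr p) \<le> (C * W) powr p" for k
  proof (rule converse_Hoelder_fin[OF pq])
    fix l :: "nat \<Rightarrow> real" assume l: "\<And>j. 0 \<le> l j"
    let ?w = "weak_norm p dual_scale (dual_space sF) (\<lambda>j. if j < k then y j else 0)"
    have w: "?w \<le> W"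
      unfolding W_def by (rule weak_norm_truncate_le[OF y zero_in_dual_space[OF sF] p])
    have lx: "lq_norm_fin q k (\<lambda>j. l j *\<^sub>R u j) \<le> lq_norm_fin q k l"
      using u l by (intro lq_norm_fin_mono) (simp add: mult_left_le)
    have "(\<Sum>j<k. l j * a j) = (\<Sum>j<k. norm (blinfun_apply (y j) (blinfun_apply T (l j *\<^sub>R u j))))"
      using l by (simp add: a_def blinfun.scaleR_right)
    also have "\<dots> \<le> C * lq_norm_fin q k (\<lambda>j. l j *\<^sub>R u j) * ?w"
      by (rule le) (rule yV)
    also have "\<dots> \<le> C * lq_norm_fin q k (\<lambda>j. l j *\<^sub>R u j) * W"
      using w C by (intro mult_left_mono) (auto simp: lq_norm_fin_nonneg)
    also have "\<dots> \<le> C * lq_norm_fin q k l * W"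
      using lx C W0 by (intro mult_left_mono mult_right_mono) auto
    finally show "(\<Sum>j<k. l j * a j) \<le> C * W * lq_norm_fin q k l" by (simp add: mult_ac)
  qed (use C W0 in \<open>auto simp: a_def\<close>)
  have "summable (\<lambda>n. a n powr p)"
    by (rule summableI_nonneg_bounded[OF _ bound]) simp
  then have "summable (\<lambda>n. 2 powr p * a n powr p)" by (rule summable_mult)
  moreover have "norm (norm (y n o\<^sub>L T) powr p) \<le> 2 powr p * a n powr p" for n
    using powr_mono2[OF _ _ u(2)[of n], of p] p by (simp add: a_def powr_mult)
  ultimately show ?thesis by (rule summable_comparison_test'[of _ 0])
qed

section \<open>Inclusion in the mid summing operators\<close>

theorem corollary5p2:
  fixes p :: real and pstar :: ennreal
    and sE :: "'k::rc_field \<Rightarrow> 'e::banach \<Rightarrow> 'e"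
    and sF :: "'k \<Rightarrow> 'f::banach \<Rightarrow> 'f"
  assumes "1 \<le> p"
    and "1 = 1 / ennreal p + 1 / pstar"
    and "banach_over sE" and "banach_over sF"
  shows "cohen_strongly_summing pstar sE sF \<subseteq> W_mid p sE sF"
proof
  fix T :: "'e \<Rightarrow>\<^sub>L 'f" assume T: "T \<in> cohen_strongly_summing pstar sE sF"
  have pq: "conjugate_exponents p pstar"
    using assms by (simp add: conjugate_exponents_def)
  have Top: "T \<in> operators sE sF" using T by (simp add: cohen_strongly_summing_def)
  show "T \<in> W_mid p sE sF"
    unfolding W_mid_def mid_lp_def
  proof (intro CollectI conjI ballI Top allI)
    fix x y assume x: "x \<in> weak_lp p sE UNIV" and y: "y \<in> weak_lp p dual_scale (dual_space sF)"
    define W where "W = weak_norm p sE UNIV x"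
    define A where "A n = norm (y n o\<^sub>L T) powr p" for n
    define b where "b j n = norm (blinfun_apply (y n) (blinfun_apply T (x j))) powr p" for j n
    have A: "summable (\<lambda>n. A n * W powr p)"
      unfolding A_def by (intro summable_mult2 cohen_adjoint_summing[OF T pq \<open>banach_over sF\<close> y])
    have "y n \<in> dual_space sF" for n using y by (auto simp: weak_lp_def)
    then have sum_b: "(\<Sum>j<m. b j n) \<le> A n * W powr p" for m n
      using weak_lp_functional[OF \<open>banach_over sE\<close> x operators_compose[OF Top] \<open>1 \<le> p\<close>]
      by (simp add: b_def A_def W_def)
    have "b j n \<le> A n * W powr p" for j n
    proof -
      have "b j n \<le> (\<Sum>i<Suc j. b i n)" by (rule member_le_sum) (auto simp: b_def)
      with sum_b[of n "Suc j"] show ?thesis by linarith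
    qed
    then have b: "summable (b j)" for j
      by (intro summable_comparison_test'[OF A, of 0]) (simp add: b_def)
    have "summable (\<lambda>j. \<Sum>n. b j n)"
    proof (rule summableI_nonneg_bounded)
      fix m
      have "(\<Sum>j<m. \<Sum>n. b j n) = (\<Sum>n. \<Sum>j<m. b j n)"
        by (intro suminf_sum[symmetric] b)
      also have "\<dots> \<le> (\<Sum>n. A n * W powr p)"
        by (intro suminf_le sum_b summable_sum b A)
      finally show "(\<Sum>j<m. \<Sum>n. b j n) \<le> (\<Sum>n. A n * W powr p)" .
    qed (intro suminf_nonneg b, simp add: b_def)
    then show "summable (\<lambda>j. \<Sum>n. norm (blinfun_apply (y n) (blinfun_apply T (x j))) powr p)"
      by (simp add: b_def)
    show "summable (\<lambda>n. norm (blinfun_apply (y n) (blinfun_apply T (x j))) powr p)" for j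
      using b[of j] by (simp add: b_def[abs_def])
  qed
qed

end
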